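(* Let $G$ be a connected graph of order $n\geq 3$ and let $k$ be an integer such that $\Delta(G)-\delta(G)\leq k<\Delta(G)$. Then $\gamma_k^{\mathrm L}(G)\leq \gamma_{1,\Delta(G)-k}(G)$.
   Context: All graphs are finite, simple and undirected; $\delta(G)$ and $\Delta(G)$ are the minimum and maximum degree and $N(v)$ is the open neighborhood of $v$. A dominating set of $G$ is a set $D\subseteq V(G)$ such that every vertex not in $D$ has a neighbor in $D$. For an integer $0\le k\le \Delta(G)$, a set $D\subseteq V(G)$ is a $k$-limited dominating set if $D$ is a dominating set and $|N(u)-D|\le k$ for every $u\in D$. $\gamma_k^{\mathrm L}(G)$ is the minimum cardinality of a $k$-limited dominating set of $G$. For an integer $t\ge 1$ and a graph $G$ with $\delta(G)\ge t$, a set $S\subseteq V(G)$ is a $(1,t)$-dominating set if every vertex in $V(G)-S$ has at least one neighbor in $S$ and every vertex in $S$ has at least $t$ neighbors in $S$; $\gamma_{1,t}(G)$ is the minimum cardinality of a $(1,t)$-dominating set. *)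

theory Defs
  imports "Graph_Theory.Digraph_Component"
begin

text \<open>
  A finite simple undirected graph is represented by a finite symmetric loop-free digraph without
  parallel arcs (locale \<^locale>\<open>graph\<close>), in which every edge occurs as a pair of opposite arcs.
  Hence \<^const>\<open>out_degree\<close> is the degree of a vertex in the undirected graph; see the lemma
  \<open>out_degree_eq_card_neighborhood\<close> below.
\<close>

definition neighborhood :: "('a, 'b) pre_digraph \<Rightarrow> 'a \<Rightarrow> 'a set" where
  "neighborhood G v = {w. v \<rightarrow>\<^bsub>G\<^esub> w}"

definition min_degree :: "('a, 'b) pre_digraph \<Rightarrow> nat" where
  "min_degree G = Min (out_degree G ` verts G)"

definition max_degree :: "('a, 'b) pre_digraph \<Rightarrow> nat" where
  "max_degree G = Max (out_degree G ` verts G)"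

definition dominating_set :: "('a, 'b) pre_digraph \<Rightarrow> 'a set \<Rightarrow> bool" where
  "dominating_set G D \<longleftrightarrow>
     D \<subseteq> verts G \<and> (\<forall>v \<in> verts G - D. neighborhood G v \<inter> D \<noteq> {})"

definition limited_dominating_set :: "('a, 'b) pre_digraph \<Rightarrow> nat \<Rightarrow> 'a set \<Rightarrow> bool" where
  "limited_dominating_set G k D \<longleftrightarrow>
     dominating_set G D \<and> (\<forall>u \<in> D. card (neighborhood G u - D) \<le> k)"

definition one_t_dominating_set :: "('a, 'b) pre_digraph \<Rightarrow> nat \<Rightarrow> 'a set \<Rightarrow> bool" where
  "one_t_dominating_set G t S \<longleftrightarrow>
     S \<subseteq> verts G \<and>
     (\<forall>v \<in> verts G - S. card (neighborhood G v \<inter> S) \<ge> 1) \<and>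
     (\<forall>v \<in> S. card (neighborhood G v \<inter> S) \<ge> t)"

text \<open>
  The following two numbers are minima of nonempty finite sets for every graph, where the second
  one needs \<open>t \<le> min_degree G\<close>: the set of all vertices is always admissible, as shown below.
\<close>

definition limited_domination_number :: "('a, 'b) pre_digraph \<Rightarrow> nat \<Rightarrow> nat" where
  "limited_domination_number G k = Min (card ` {D. limited_dominating_set G k D})"

definition one_t_domination_number :: "('a, 'b) pre_digraph \<Rightarrow> nat \<Rightarrow> nat" where
  "one_t_domination_number G t = Min (card ` {S. one_t_dominating_set G t S})"

lemma (in wf_digraph) neighborhood_subset_verts: "neighborhood G v \<subseteq> verts G"
  by (auto simp: neighborhood_def dest: adj_in_verts)

lemma (in nomulti_digraph) out_degree_eq_card_neighborhood:
  "out_degree G v = card (neighborhood G v)"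
proof -
  have "neighborhood G v = head G ` out_arcs G v"
    by (force simp: neighborhood_def arcs_ends_conv out_arcs_def)
  moreover have "inj_on (head G) (out_arcs G v)"
    by (auto intro!: inj_onI no_multi_arcs simp: arc_to_ends_def)
  ultimately show ?thesis
    by (simp add: out_degree_def card_image)
qed

lemma limited_dominating_set_verts:
  assumes "graph G"
  shows "limited_dominating_set G k (verts G)"
proof -
  interpret graph G by fact
  have "card (neighborhood G u - verts G) = 0" for u
    using neighborhood_subset_verts[of u] by (metis Diff_eq_empty_iff card.empty)
  then show ?thesis
    by (simp add: limited_dominating_set_def dominating_set_def)
qed

lemma one_t_dominating_set_verts:
  assumes "graph G" "t \<le> min_degree G"
  shows "one_t_dominating_set G t (verts G)"
proof -
  interpret graph G by fact
  have "t \<le> card (neighborhood G v \<inter> verts G)" if "v \<in> verts G" for v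
  proof -
    have "neighborhood G v \<inter> verts G = neighborhood G v"
      using neighborhood_subset_verts by blast
    moreover have "min_degree G \<le> out_degree G v"
      using that by (simp add: min_degree_def)
    ultimately show ?thesis
      using assms(2) by (simp add: out_degree_eq_card_neighborhood)
  qed
  then show ?thesis
    by (simp add: one_t_dominating_set_def)
qed

lemma finite_limited_dominating_sets:
  assumes "graph G"
  shows "finite {D. limited_dominating_set G k D}"
proof -
  interpret graph G by fact
  show ?thesis
    by (rule finite_subset[of _ "Pow (verts G)"])
      (auto simp: limited_dominating_set_def dominating_set_def)
qed

lemma finite_one_t_dominating_sets:
  assumes "graph G"
  shows "finite {S. one_t_dominating_set G t S}"
proof -
  interpret graph G by fact
  show ?thesis
    by (rule finite_subset[of _ "Pow (verts G)"]) (auto simp: one_t_dominating_set_def)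
qed

end

theory Submission
  imports Defs
begin

text \<open>
  Every \<open>(1,\<Delta> - k)\<close>-dominating set \<open>S\<close> is itself a \<open>k\<close>-limited dominating set: a vertex of \<open>S\<close>
  has at most \<open>\<Delta>\<close> neighbors, and at least \<open>\<Delta> - k\<close> of them lie in \<open>S\<close>, which leaves at most \<open>k\<close>
  outside. The bound then compares two minima over nested families. The assumption
  \<open>\<Delta> - \<delta> \<le> k\<close> makes the smaller family nonempty, because it says that every degree is at
  least \<open>\<Delta> - k\<close>, so that the set of all vertices belongs to it.
\<close>

lemma (in graph) card_neighborhood_le_max_degree:
  assumes "v \<in> verts G"
  shows "card (neighborhood G v) \<le> max_degree G"
  using assms by (simp add: max_degree_def flip: out_degree_eq_card_neighborhood)

lemma one_t_dominating_set_imp_limited: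
  assumes "graph G" "one_t_dominating_set G (max_degree G - k) S"
  shows "limited_dominating_set G k S"
proof -
  interpret graph G by fact
  have "neighborhood G v \<inter> S \<noteq> {}" if "v \<in> verts G - S" for v
  proof -
    have "card (neighborhood G v \<inter> S) \<ge> 1"
      using assms(2) that unfolding one_t_dominating_set_def by blast
    then show ?thesis by auto
  qed
  moreover have "card (neighborhood G u - S) \<le> k" if "u \<in> S" for u
  proof -
    have "finite (neighborhood G u)"
      using neighborhood_subset_verts by (rule finite_subset) simp
    then have "card (neighborhood G u) = card (neighborhood G u \<inter> S) + card (neighborhood G u - S)"
      by (rule card_Int_Diff)
    moreover have "card (neighborhood G u) \<le> max_degree G"
      using assms(2) that
      by (intro card_neighborhood_le_max_degree) (auto simp: one_t_dominating_set_def)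
    moreover have "max_degree G - k \<le> card (neighborhood G u \<inter> S)"
      using assms(2) that by (simp add: one_t_dominating_set_def)
    ultimately show ?thesis by linarith
  qed
  ultimately show ?thesis
    using assms(2)
    by (simp add: limited_dominating_set_def dominating_set_def one_t_dominating_set_def)
qed

theorem proposition8:
  fixes G :: "('a, 'b) pre_digraph" and k :: nat
  assumes "graph G"
    and "connected G"
    and "card (verts G) \<ge> 3"
    and "max_degree G - min_degree G \<le> k"
    and "k < max_degree G"
  shows "limited_domination_number G k \<le> one_t_domination_number G (max_degree G - k)"
  unfolding limited_domination_number_def one_t_domination_number_def
proof (rule Min_antimono)
  show "card ` {S. one_t_dominating_set G (max_degree G - k) S}
      \<subseteq> card ` {D. limited_dominating_set G k D}"
    using one_t_dominating_set_imp_limited[OF assms(1)] by blast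
  have "max_degree G - k \<le> min_degree G"
    using assms(4) by linarith
  then show "card ` {S. one_t_dominating_set G (max_degree G - k) S} \<noteq> {}"
    using one_t_dominating_set_verts[OF assms(1)] by blast
  show "finite (card ` {D. limited_dominating_set G k D})"
    using finite_limited_dominating_sets[OF assms(1)] by (rule finite_imageI)
qed

end
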